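(* Let $m,n\ge 1$ be integers. The set $\mathsf{Necklaces}_1(m,m-1,n)$ is in one-to-one correspondence with the set of weakly decreasing recurrent configurations of the Abelian sandpile model on the complete split graph $S_{m,n}$ with sink the clique vertex $v_m$, via the following association: if $\alpha\in\mathsf{Motzkin}_{m-1,n}$ is the (unique) Motzkin word with $f(\alpha)=c$ for the weakly decreasing recurrent configuration $c$, then the necklace corresponding to $c$ is the one whose clockwise reading is $U\alpha$, i.e. the word $\alpha$ with the letter $U$ prepended.
   Context: The complete split graph $S_{m,n}$ has clique vertices $v_1,\ldots,v_m$ and independent vertices $w_1,\ldots,w_n$. Every two distinct clique vertices are joined by one edge, every clique vertex is joined to every independent vertex by one edge, and no two independent vertices are adjacent. Abelian sandpile model on a graph $G$ with sink $s$: a configuration assigns a non-negative integer (number of grains) to each non-sink vertex. A non-sink vertex $v$ is stable if its number of grains is strictly less than $\deg(v)$, and unstable otherwise. A configuration is stable if all non-sink vertices are stable. An unstable vertex may topple, i.e. it loses $\deg(v)$ grains and gives one grain to each neighbour; grains given to the sink disappear. Toppling unstable vertices eventually leads to a unique stable configuration, the stabilisation. A stable configuration $c$ is recurrent if it can be reached, by adding grains and toppling, from every configuration: for every configuration $d$ there is a configuration $e$ such that the stabilisation of $d+e$ is $c$. With sink $v_m$, a configuration is written $(a_1,\ldots,a_{m-1},-;b_1,\ldots,b_n)$ where $a_i$ is the number of grains at $v_i$ and $b_j$ the number of grains at $w_j$; it is weakly decreasing if $a_1\ge\cdots\ge a_{m-1}$ and $b_1\ge\cdots\ge b_n$. A Motzkin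 word is a word in the letters $U,D,H$ such that every prefix contains at least as many $U$'s as $D$'s, and the total numbers of $U$'s and $D$'s are equal. $\mathsf{Motzkin}_{p,q}$ is the set of Motzkin words with exactly $p$ letters $U$ and $q$ letters $H$. For $\alpha\in\mathsf{Motzkin}_{m-1,n}$, the configuration $f(\alpha)=(a_1,\ldots,a_{m-1},-;b_1,\ldots,b_n)$ is defined by: $a_i+1$ is the number of letters of $\alpha$ equal to $D$ or $H$ appearing after the $i$-th occurrence of $U$; $b_i$ is the number of letters $D$ appearing after the $i$-th occurrence of $H$. The map $f$ is a bijection from $\mathsf{Motzkin}_{m-1,n}$ onto the weakly decreasing recurrent configurations on $S_{m,n}$ with sink $v_m$. A combinatorial necklace is an arrangement of coloured beads in a circle, considered up to rotation (equivalently, a word up to cyclic shift; reflections are not identified). $\mathsf{Necklaces}_1(a,b,c)$ is the set of all different necklaces on the colours $\{U,D,H\}$ with $a$ beads coloured $U$, $b$ beads coloured $D$ and $c$ beads coloured $H$. *)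

theory Defs
  imports Main
begin

text \<open>
  Abelian sandpile model on a finite simple graph with vertex set \<open>V\<close>, edge set \<open>E\<close> (a set of
  two-element sets) and sink \<open>s\<close>.
\<close>

type_synonym 'v config = "'v \<Rightarrow> nat"

definition neighbours :: "'v set set \<Rightarrow> 'v \<Rightarrow> 'v set" where
  "neighbours E v = {u. {v, u} \<in> E}"

definition deg :: "'v set set \<Rightarrow> 'v \<Rightarrow> nat" where
  "deg E v = card (neighbours E v)"

text \<open>
  A configuration only has entries at the non-sink vertices; the total function representing it
  is normalised to 0 at the sink and outside \<open>V\<close>, so that equality of functions is equality
  of configurations.
\<close>

definition configs :: "'v set \<Rightarrow> 'v \<Rightarrow> 'v config set" where
  "configs V s = {c. \<forall>v. v \<notin> V - {s} \<longrightarrow> c v = 0}"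

definition unstable :: "'v set set \<Rightarrow> 'v config \<Rightarrow> 'v \<Rightarrow> bool" where
  "unstable E c v \<longleftrightarrow> deg E v \<le> c v"

definition stable :: "'v set \<Rightarrow> 'v set set \<Rightarrow> 'v \<Rightarrow> 'v config \<Rightarrow> bool" where
  "stable V E s c \<longleftrightarrow> (\<forall>v \<in> V - {s}. c v < deg E v)"

definition topple :: "'v set set \<Rightarrow> 'v \<Rightarrow> 'v \<Rightarrow> 'v config \<Rightarrow> 'v config" where
  "topple E s v c =
     (\<lambda>u. if u = s then 0
          else if u = v then c u - deg E v
          else if u \<in> neighbours E v then c u + 1
          else c u)"

definition topples_to :: "'v set \<Rightarrow> 'v set set \<Rightarrow> 'v \<Rightarrow> 'v config \<Rightarrow> 'v config \<Rightarrow> bool" where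
  "topples_to V E s c c' \<longleftrightarrow> (\<exists>v \<in> V - {s}. unstable E c v \<and> c' = topple E s v c)"

text \<open>\<open>is_stabilisation V E s c c'\<close>: the stabilisation of \<open>c\<close> is \<open>c'\<close>.\<close>

definition is_stabilisation ::
    "'v set \<Rightarrow> 'v set set \<Rightarrow> 'v \<Rightarrow> 'v config \<Rightarrow> 'v config \<Rightarrow> bool" where
  "is_stabilisation V E s c c' \<longleftrightarrow> (topples_to V E s)\<^sup>*\<^sup>* c c' \<and> stable V E s c'"

definition recurrent :: "'v set \<Rightarrow> 'v set set \<Rightarrow> 'v \<Rightarrow> 'v config \<Rightarrow> bool" where
  "recurrent V E s c \<longleftrightarrow>
     c \<in> configs V s \<and> stable V E s c \<and>
     (\<forall>d \<in> configs V s. \<exists>e \<in> configs V s. is_stabilisation V E s (\<lambda>v. d v + e v) c)"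


text \<open>The complete split graph: \<open>Clique i\<close> is $v_i$ and \<open>Indep j\<close> is $w_j$, numbered from 1.\<close>

datatype vertex = Clique nat | Indep nat

definition split_verts :: "nat \<Rightarrow> nat \<Rightarrow> vertex set" where
  "split_verts m n = Clique ` {1..m} \<union> Indep ` {1..n}"

definition split_edges :: "nat \<Rightarrow> nat \<Rightarrow> vertex set set" where
  "split_edges m n =
     {{Clique i, Clique j} |i j. i \<in> {1..m} \<and> j \<in> {1..m} \<and> i \<noteq> j} \<union>
     {{Clique i, Indep j} |i j. i \<in> {1..m} \<and> j \<in> {1..n}}"

definition weakly_decreasing :: "nat \<Rightarrow> nat \<Rightarrow> vertex config \<Rightarrow> bool" where
  "weakly_decreasing m n c \<longleftrightarrow>
     (\<forall>i j. 1 \<le> i \<and> i \<le> j \<and> j \<le> m - 1 \<longrightarrow> c (Clique j) \<le> c (Clique i)) \<and>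
     (\<forall>i j. 1 \<le> i \<and> i \<le> j \<and> j \<le> n \<longrightarrow> c (Indep j) \<le> c (Indep i))"

definition decreasing_recurrent :: "nat \<Rightarrow> nat \<Rightarrow> vertex config set" where
  "decreasing_recurrent m n =
     {c. recurrent (split_verts m n) (split_edges m n) (Clique m) c \<and> weakly_decreasing m n c}"


datatype letter = U | D | H

definition Motzkin :: "nat \<Rightarrow> nat \<Rightarrow> letter list set" where
  "Motzkin p q =
     {w. (\<forall>k. count_list (take k w) D \<le> count_list (take k w) U) \<and>
         count_list w U = count_list w D \<and>
         count_list w U = p \<and> count_list w H = q}"

text \<open>\<open>after x i w\<close> is the part of \<open>w\<close> strictly to the right of the \<open>i\<close>-th occurrence of \<open>x\<close>
  (counting from 1).\<close>

fun after :: "'a \<Rightarrow> nat \<Rightarrow> 'a list \<Rightarrow> 'a list" where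
  "after x 0 w = w"
| "after x (Suc i) w = after x i (tl (dropWhile (\<lambda>y. y \<noteq> x) w))"

text \<open>
  For \<open>w \<in> Motzkin (m - 1) n\<close> and \<open>i \<in> {1..m - 1}\<close> some \<open>D\<close> follows the \<open>i\<close>-th \<open>U\<close>, so the
  subtraction below does not truncate.
\<close>

definition motzkin_config :: "nat \<Rightarrow> nat \<Rightarrow> letter list \<Rightarrow> vertex config" where
  "motzkin_config m n w v =
     (case v of
        Clique i \<Rightarrow>
          if i \<in> {1..m - 1}
          then count_list (after U i w) D + count_list (after U i w) H - 1 else 0
      | Indep j \<Rightarrow>
          if j \<in> {1..n} then count_list (after H j w) D else 0)"


definition necklace :: "'a list \<Rightarrow> 'a list set" where
  "necklace w = {rotate k w |k. True}"

definition Necklaces1 :: "nat \<Rightarrow> nat \<Rightarrow> nat \<Rightarrow> letter list set set" where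
  "Necklaces1 a b c =
     necklace ` {w. count_list w U = a \<and> count_list w D = b \<and> count_list w H = c}"

end

theory Submission
  imports Defs
begin

text \<open>
  The correspondence is the composition of two bijections out of the set of Motzkin words, with
  \<open>motzkin_config\<close> inverted.

  The first, \<open>bij_betw_motzkin_config\<close>, rests on Dhar's criterion. Every vertex of the split graph
  is adjacent to the sink, so firing the sink adds one grain everywhere, and a stable
  configuration is recurrent if and only if no set of vertices is forbidden
  (\<open>recurrent_imp_unforbidden\<close>, \<open>unforbidden_imp_recurrent\<close>). For a weakly decreasing
  configuration only final segments \<open>v\<^sub>i\<^sub>+\<^sub>1, \<dots>, v\<^sub>m\<^sub>-\<^sub>1\<close>, \<open>w\<^sub>j\<^sub>+\<^sub>1, \<dots>, w\<^sub>n\<close> need to be tested,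
  which leaves the inequalities \<open>burning_lists\<close> on two sorted lists of numbers
  (\<open>decreasing_recurrent_iff\<close>). A Motzkin word is a record of a burning order: its \<open>U\<close> and \<open>H\<close>
  stand for the clique and independent vertices in the order in which they burn. From the two lists
  the word can be read off letter by letter (\<open>counts_inj\<close>), and the inequalities
  say precisely that this reading never runs short of letters \<open>D\<close> (\<open>counts_surj\<close>).

  The second, \<open>bij_betw_Motzkin_Necklaces1\<close>, is the cycle lemma. Count \<open>U\<close>, \<open>D\<close>, \<open>H\<close> as 1, -1, 0.
  A circular word of total 1 has exactly one starting point from which all nonempty partial
  sums are positive, and linear words with this property and total 1 are exactly \<open>U\<close> followed
  by a Motzkin word.
\<close>

section \<open>Recurrence and forbidden subconfigurations\<close>

text \<open>
  This is the statement that \<open>c\<close> has no forbidden subconfiguration in the sense of Dhar. It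
  mentions no toppling sequence, and therefore becomes a finite list of inequalities between
  the entries of \<open>c\<close> once the graph is known.
\<close>

definition unforbidden :: "'v set \<Rightarrow> 'v set set \<Rightarrow> 'v \<Rightarrow> 'v config \<Rightarrow> bool" where
  "unforbidden V E s c \<longleftrightarrow>
     (\<forall>A. A \<subseteq> V - {s} \<and> A \<noteq> {} \<longrightarrow> (\<exists>v\<in>A. card (neighbours E v \<inter> A) \<le> c v))"

lemma neighbours_sym: "u \<in> neighbours E v \<longleftrightarrow> v \<in> neighbours E u"
  by (simp add: neighbours_def insert_commute)

text \<open>
  A vertex that has just toppled cannot be the obstruction in \<open>{v}\<close>, and for every other set
  containing \<open>v\<close> a witness for \<open>A - {v}\<close> still works for \<open>A\<close>, because it received a grain from
  \<open>v\<close> exactly when \<open>v\<close> is its neighbour.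
\<close>

lemma topples_to_unforbidden:
  assumes step: "topples_to V E s c c'" and unf: "unforbidden V E s c"
    and loopless: "\<And>v. v \<notin> neighbours E v"
  shows "unforbidden V E s c'"
  unfolding unforbidden_def
proof (intro allI impI, elim conjE)
  fix A assume A: "A \<subseteq> V - {s}" "A \<noteq> {}"
  obtain v where c': "c' = topple E s v c"
    using step by (auto simp: topples_to_def)
  show "\<exists>u\<in>A. card (neighbours E u \<inter> A) \<le> c' u"
  proof (cases "v \<in> A")
    case False
    obtain u where u: "u \<in> A" "card (neighbours E u \<inter> A) \<le> c u"
      using unf A by (auto simp: unforbidden_def)
    have "c u \<le> c' u"
      using u A False by (auto simp: c' topple_def)
    with u show ?thesis by (meson le_trans)
  next
    case True
    show ?thesis
    proof (cases "A = {v}")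
      case True
      then show ?thesis using loopless by auto
    next
      case False
      then have "A - {v} \<noteq> {}" "A - {v} \<subseteq> V - {s}" using A by auto
      then obtain u where u: "u \<in> A - {v}" "card (neighbours E u \<inter> (A - {v})) \<le> c u"
        using unf unfolding unforbidden_def by blast
      have *: "neighbours E u \<inter> A =
          (if u \<in> neighbours E v then insert v (neighbours E u \<inter> (A - {v}))
           else neighbours E u \<inter> (A - {v}))"
        using True neighbours_sym[of u E v] by auto
      have "card (neighbours E u \<inter> A) \<le> c' u"
        using u A card_insert_le_m1[of "Suc (c u)" "neighbours E u \<inter> (A - {v})" v]
        unfolding * by (auto simp: c' topple_def)
      with u show ?thesis by auto
    qed
  qed
qed

text \<open>
  A recurrent configuration can be reached from one in which every vertex is unstable. That one
  is unforbidden, and toppling preserves this.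
\<close>

lemma recurrent_imp_unforbidden:
  assumes rec: "recurrent V E s c"
    and loopless: "\<And>v. v \<notin> neighbours E v"
    and fin: "\<And>v. finite (neighbours E v)"
  shows "unforbidden V E s c"
proof -
  define d where "d = (\<lambda>v. if v \<in> V - {s} then deg E v else 0)"
  have "d \<in> configs V s" by (auto simp: d_def configs_def)
  then obtain e where e: "(topples_to V E s)\<^sup>*\<^sup>* (\<lambda>v. d v + e v) c"
    using rec unfolding recurrent_def is_stabilisation_def by blast
  have "unforbidden V E s (\<lambda>v. d v + e v)"
    unfolding unforbidden_def
  proof (intro allI impI, elim conjE)
    fix A assume A: "A \<subseteq> V - {s}" "A \<noteq> {}"
    then obtain v where v: "v \<in> A" by blast
    have "card (neighbours E v \<inter> A) \<le> deg E v"
      unfolding deg_def by (rule card_mono) (use fin in auto)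
    then show "\<exists>v\<in>A. card (neighbours E v \<inter> A) \<le> d v + e v"
      using v A by (intro bexI[of _ v]) (auto simp: d_def)
  qed
  from e this show ?thesis
  proof (induction rule: rtranclp_induct)
    case (step y z)
    then show ?case using topples_to_unforbidden[OF step(2) _ loopless] by simp
  qed
qed

lemma topples_to_add:
  assumes "topples_to V E s x y" and "e s = 0"
  shows "topples_to V E s (\<lambda>v. x v + e v) (\<lambda>v. y v + e v)"
proof -
  obtain v where v: "v \<in> V - {s}" "deg E v \<le> x v" "y = topple E s v x"
    using assms(1) by (auto simp: topples_to_def unstable_def)
  then have "(\<lambda>v. y v + e v) = topple E s v (\<lambda>v. x v + e v)"
    using assms(2) by (auto simp: topple_def fun_eq_iff)
  with v show ?thesis
    by (auto simp: topples_to_def unstable_def intro!: bexI[of _ v])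
qed

lemma topples_to_star_add:
  assumes "(topples_to V E s)\<^sup>*\<^sup>* x y" and "e s = 0"
  shows "(topples_to V E s)\<^sup>*\<^sup>* (\<lambda>v. x v + e v) (\<lambda>v. y v + e v)"
  using assms(1)
proof (induction rule: rtranclp_induct)
  case (step y z)
  then show ?case
    using topples_to_add[OF step(2), of e] assms(2) by simp
qed auto

text \<open>
  Dhar's burning process when the sink is adjacent to every vertex. After one grain is added
  everywhere (this is the effect of firing the sink), the nonempty set \<open>A\<close> of vertices that have not yet
  toppled contains an unstable one, namely the witness for \<open>A\<close>: all its neighbours outside \<open>A\<close>,
  the sink among them, have sent it a grain. Once every vertex has toppled exactly once, each has
  received \<open>deg E v\<close> grains and lost as many, so \<open>c\<close> is back.
\<close>

lemma unforbidden_burns: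
  assumes unf: "unforbidden V E s c"
    and c: "c \<in> configs V s"
    and loopless: "\<And>v. v \<notin> neighbours E v"
    and finV: "finite V" and nb: "\<And>v. neighbours E v \<subseteq> V"
    and sink: "\<And>v. v \<in> V - {s} \<Longrightarrow> s \<in> neighbours E v"
  shows "(topples_to V E s)\<^sup>*\<^sup>* (\<lambda>v. c v + (if v \<in> V - {s} then 1 else 0)) c"
proof -
  have fin: "finite (neighbours E v)" for v
    using nb finV finite_subset by blast
  define x where "x = (\<lambda>B v. if v \<in> V - {s} then
       c v + 1 + card (neighbours E v \<inter> B) - (if v \<in> B then deg E v else 0) else 0)"
  have "\<exists>B\<subseteq>V - {s}. card B = k \<and> (topples_to V E s)\<^sup>*\<^sup>* (x {}) (x B) \<and>
          (\<forall>v\<in>B. deg E v \<le> c v + 1 + card (neighbours E v \<inter> B))"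
    if "k \<le> card (V - {s})" for k
    using that
  proof (induction k)
    case 0
    then show ?case by (intro exI[of _ "{}"]) auto
  next
    case (Suc k)
    then obtain B where B: "B \<subseteq> V - {s}" "card B = k" "(topples_to V E s)\<^sup>*\<^sup>* (x {}) (x B)"
      "\<And>v. v \<in> B \<Longrightarrow> deg E v \<le> c v + 1 + card (neighbours E v \<inter> B)"
      by auto
    have finB: "finite B" using B(1) finV finite_subset by blast
    have "V - {s} - B \<noteq> {}"
    proof
      assume "V - {s} - B = {}"
      then have "V - {s} = B" using B(1) by blast
      then show False using Suc.prems B(2) by simp
    qed
    then obtain v where v: "v \<in> V - {s} - B" "card (neighbours E v \<inter> (V - {s} - B)) \<le> c v"
      using unf unfolding unforbidden_def by (metis Diff_subset)
    have "deg E v \<le> card (neighbours E v \<inter> (V - {s} - B) \<union> (neighbours E v \<inter> B) \<union> {s})"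
      unfolding deg_def by (rule card_mono) (use nb[of v] fin in auto)
    also have "\<dots> \<le> card (neighbours E v \<inter> (V - {s} - B)) + card (neighbours E v \<inter> B) + 1"
      by (intro order.trans[OF card_Un_le] add_mono) (auto intro: card_Un_le)
    finally have deg: "deg E v \<le> c v + 1 + card (neighbours E v \<inter> B)" using v by simp
    have ins: "card (neighbours E u \<inter> insert v B) =
        card (neighbours E u \<inter> B) + (if u \<in> neighbours E v then 1 else 0)" for u
      using v finB neighbours_sym[of u E v] by (auto simp: Int_insert_right)
    have "x (insert v B) = topple E s v (x B)"
    proof
      fix u
      show "x (insert v B) u = topple E s v (x B) u"
        using v loopless[of v] nb[of v] B(4)[of u] by (auto simp: x_def topple_def ins)
    qed
    moreover have "unstable E (x B) v"
      using v deg by (auto simp: x_def unstable_def)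
    ultimately have "topples_to V E s (x B) (x (insert v B))"
      using v unfolding topples_to_def by blast
    with B(3) have "(topples_to V E s)\<^sup>*\<^sup>* (x {}) (x (insert v B))" by simp
    moreover have "\<forall>u\<in>insert v B. deg E u \<le> c u + 1 + card (neighbours E u \<inter> insert v B)"
      using deg B(4) unfolding ins by (fastforce intro: trans_le_add1)
    ultimately show ?case
      using v B(1,2) finB by (intro exI[of _ "insert v B"]) auto
  qed
  from this[of "card (V - {s})"] obtain B where B: "B \<subseteq> V - {s}" "card B = card (V - {s})"
    "(topples_to V E s)\<^sup>*\<^sup>* (x {}) (x B)" by auto
  have "B = V - {s}" using B finV by (intro card_subset_eq) auto
  moreover have "card (neighbours E v \<inter> (V - {s})) + 1 = deg E v" if "v \<in> V - {s}" for v
  proof -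
    have "neighbours E v = insert s (neighbours E v \<inter> (V - {s}))"
      using sink[OF that] nb[of v] by auto
    then have "deg E v = card (insert s (neighbours E v \<inter> (V - {s})))" by (simp add: deg_def)
    then show ?thesis using fin by simp
  qed
  ultimately have "x B v = c v" for v
    using c by (cases "v \<in> V - {s}") (fastforce simp: x_def configs_def)+
  then have "x B = c" by (rule ext)
  moreover have "x {} = (\<lambda>v. c v + (if v \<in> V - {s} then 1 else 0))"
    using c by (auto simp: x_def fun_eq_iff configs_def)
  ultimately show ?thesis using B(3) by simp
qed

text \<open>
  Repeating the burning process shows that adding any constant to \<open>c\<close> stabilises to \<open>c\<close>;
  a large enough constant exceeds any given configuration.
\<close>

lemma unforbidden_imp_recurrent:
  assumes unf: "unforbidden V E s c"
    and c: "c \<in> configs V s" and st: "stable V E s c"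
    and loopless: "\<And>v. v \<notin> neighbours E v"
    and finV: "finite V" and nb: "\<And>v. neighbours E v \<subseteq> V"
    and sink: "\<And>v. v \<in> V - {s} \<Longrightarrow> s \<in> neighbours E v"
  shows "recurrent V E s c"
proof -
  have const: "(topples_to V E s)\<^sup>*\<^sup>* (\<lambda>v. c v + (if v \<in> V - {s} then k else 0)) c" for k
  proof (induction k)
    case 0
    then show ?case by simp
  next
    case (Suc k)
    have "(\<lambda>v. c v + (if v \<in> V - {s} then Suc k else 0)) =
      (\<lambda>v. c v + (if v \<in> V - {s} then 1 else 0) + (if v \<in> V - {s} then k else 0))" by auto
    then show ?case
      using topples_to_star_add[OF unforbidden_burns[OF unf c loopless finV nb sink],
          of "\<lambda>v. if v \<in> V - {s} then k else 0"] Suc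
      by auto
  qed
  have "\<exists>e\<in>configs V s. is_stabilisation V E s (\<lambda>v. d v + e v) c" if d: "d \<in> configs V s" for d
  proof -
    define k where "k = sum d V"
    have k: "d v \<le> k" if "v \<in> V" for v
      using that finV by (auto simp: k_def intro: member_le_sum)
    define e where "e = (\<lambda>v. c v + (if v \<in> V - {s} then k else 0) - d v)"
    have "(\<lambda>v. d v + e v) = (\<lambda>v. c v + (if v \<in> V - {s} then k else 0))"
      using d k by (force simp: e_def configs_def fun_eq_iff trans_le_add2)
    moreover have "e \<in> configs V s" using c by (auto simp: e_def configs_def)
    ultimately show ?thesis
      using const[of k] st unfolding is_stabilisation_def by (intro bexI[of _ e]) simp_all
  qed
  then show ?thesis using c st by (auto simp: recurrent_def)
qed

section \<open>Words and their lists of counts\<close>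

text \<open>
  The two families of numbers behind \<open>motzkin_config\<close> as structurally recursive lists, which
  makes them accessible to induction on the word.
\<close>

fun u_counts :: "letter list \<Rightarrow> nat list" where
  "u_counts [] = []"
| "u_counts (x # w) =
     (if x = U then (count_list w D + count_list w H) # u_counts w else u_counts w)"

fun h_counts :: "letter list \<Rightarrow> nat list" where
  "h_counts [] = []"
| "h_counts (x # w) = (if x = H then count_list w D # h_counts w else h_counts w)"

definition nonneg_suffixes :: "letter list \<Rightarrow> bool" where
  "nonneg_suffixes w \<longleftrightarrow> (\<forall>k. count_list (drop k w) U \<le> count_list (drop k w) D)"

text \<open>
  The absence of forbidden subconfigurations for a weakly decreasing configuration on the split
  graph, with \<open>as\<close> listing the \<open>a\<^sub>i + 1\<close> and \<open>bs\<close> the \<open>b\<^sub>j\<close>: among sets with \<open>p\<close> clique and \<open>q\<close>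
  independent vertices the last \<open>p\<close> and the last \<open>q\<close> are the ones most likely to be forbidden,
  and within such a set the largest entries come first.
\<close>

definition burning_lists :: "nat list \<Rightarrow> nat list \<Rightarrow> bool" where
  "burning_lists as bs \<longleftrightarrow>
     (\<forall>i \<le> length as. \<forall>j \<le> length bs.
        i = length as \<and> j = length bs \<or>
        i < length as \<and> length as - i + (length bs - j) \<le> as ! i \<or>
        j < length bs \<and> length as - i \<le> bs ! j)"

lemma length_u_counts: "length (u_counts w) = count_list w U"
  by (induction w) auto

lemma length_h_counts: "length (h_counts w) = count_list w H"
  by (induction w) auto

lemma u_counts_le: "x \<in> set (u_counts w) \<Longrightarrow> x \<le> count_list w D + count_list w H"
  by (induction w) (force split: if_splits)+

lemma h_counts_le: "x \<in> set (h_counts w) \<Longrightarrow> x \<le> count_list w D"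
  by (induction w) (force split: if_splits)+

lemma sorted_u_counts: "sorted_wrt (\<ge>) (u_counts w)"
  by (induction w) (auto dest: u_counts_le)

lemma sorted_h_counts: "sorted_wrt (\<ge>) (h_counts w)"
  by (induction w) (auto dest: h_counts_le)

lemma u_counts_nth:
  "i < count_list w U \<Longrightarrow>
   u_counts w ! i = count_list (after U (Suc i) w) D + count_list (after U (Suc i) w) H"
  by (induction w arbitrary: i) (auto simp: nth_Cons split: nat.split)

lemma h_counts_nth:
  "i < count_list w H \<Longrightarrow> h_counts w ! i = count_list (after H (Suc i) w) D"
  by (induction w arbitrary: i) (auto simp: nth_Cons split: nat.split)

lemma nonneg_suffixes_Cons:
  "nonneg_suffixes (x # w) \<longleftrightarrow>
     nonneg_suffixes w \<and> count_list (x # w) U \<le> count_list (x # w) D"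
proof -
  have "(\<forall>k. P k) \<longleftrightarrow> P 0 \<and> (\<forall>k. P (Suc k))" for P :: "nat \<Rightarrow> bool"
    by (metis not0_implies_Suc)
  from this[of "\<lambda>k. count_list (drop k (x # w)) U \<le> count_list (drop k (x # w)) D"]
  show ?thesis by (auto simp: nonneg_suffixes_def)
qed

lemma nonneg_suffixes_le: "nonneg_suffixes w \<Longrightarrow> count_list w U \<le> count_list w D"
  unfolding nonneg_suffixes_def by (metis drop0)

lemma burning_lists_Cons1:
  "burning_lists (a # as) bs \<longleftrightarrow> burning_lists as bs \<and>
     (\<forall>j \<le> length bs. Suc (length as) + (length bs - j) \<le> a \<or>
        j < length bs \<and> Suc (length as) \<le> bs ! j)"
proof -
  have "(\<forall>i\<le>Suc l. P i) \<longleftrightarrow> P 0 \<and> (\<forall>i\<le>l. P (Suc i))" for P :: "nat \<Rightarrow> bool" and l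
    by (metis Suc_le_mono not0_implies_Suc zero_le)
  then show ?thesis unfolding burning_lists_def by auto
qed

lemma burning_lists_Cons2:
  "burning_lists as (b # bs) \<longleftrightarrow> burning_lists as bs \<and>
     (\<forall>i \<le> length as. i < length as \<and> length as - i + Suc (length bs) \<le> as ! i \<or>
        length as - i \<le> b)"
proof -
  have "(\<forall>i\<le>Suc l. P i) \<longleftrightarrow> P 0 \<and> (\<forall>i\<le>l. P (Suc i))" for P :: "nat \<Rightarrow> bool" and l
    by (metis Suc_le_mono not0_implies_Suc zero_le)
  then show ?thesis unfolding burning_lists_def by auto
qed

text \<open>
  Reading the word from left to right is a burning order: behind a letter \<open>U\<close> there are more
  letters \<open>D\<close> than \<open>U\<close>, behind a letter \<open>H\<close> at least as many.
\<close>

lemma burning_lists_counts: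
  assumes "nonneg_suffixes w"
  shows "burning_lists (u_counts w) (h_counts w)"
  using assms
proof (induction w)
  case Nil
  then show ?case by (simp add: burning_lists_def)
next
  case (Cons x w)
  then have IH: "burning_lists (u_counts w) (h_counts w)"
    and le: "count_list (x # w) U \<le> count_list (x # w) D" "count_list w U \<le> count_list w D"
    by (auto simp: nonneg_suffixes_Cons nonneg_suffixes_le)
  show ?case
    using IH le
    by (cases x) (auto simp: burning_lists_Cons1 burning_lists_Cons2 length_u_counts length_h_counts)
qed

text \<open>
  The next letter is forced: it is \<open>U\<close> exactly when the first \<open>U\<close>-count equals the total number
  of remaining letters \<open>D\<close> and \<open>H\<close>; failing that, it is \<open>H\<close> exactly when the first \<open>H\<close>-count is
  the number of remaining \<open>D\<close>.
\<close>

lemma counts_inj: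
  assumes "u_counts w = u_counts w'" "h_counts w = h_counts w'"
    and "count_list w D = count_list w' D"
  shows "w = w'"
  using assms
proof (induction w arbitrary: w')
  case Nil
  then have "count_list w' x = 0" for x
    using length_u_counts[of w'] length_h_counts[of w'] by (cases x) auto
  then show ?case by (metis count_list_0_iff list.set_intros(1) neq_Nil_conv)
next
  case (Cons x w)
  have cU: "count_list (x # w) U = count_list w' U"
    using Cons.prems(1) by (metis length_u_counts)
  have cH: "count_list (x # w) H = count_list w' H"
    using Cons.prems(2) by (metis length_h_counts)
  have "w' \<noteq> []"
    using Cons.prems(3) cU cH by (cases x) auto
  then obtain y v where w': "w' = y # v" by (cases w') auto
  have bU: "t \<le> count_list z D + count_list z H" if "t # ts = u_counts z" for t ts z
    using u_counts_le[of t z] that[symmetric] by simp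
  have bH: "t \<le> count_list z D" if "t # ts = h_counts z" for t ts z
    using h_counts_le[of t z] that[symmetric] by simp
  have "x = y"
    using Cons.prems cU cH unfolding w'
    by (cases x; cases y) (auto dest: bU bH bU[OF sym] bH[OF sym])
  then show ?case
    using Cons.prems Cons.IH[of v] unfolding w' by (cases y) auto
qed

text \<open>
  The same rule builds a word from lists of counts. The letter \<open>D\<close> is written only when neither
  first count attains its bound; then \<open>burning_lists\<close> guarantees more remaining \<open>D\<close> than \<open>U\<close>.
\<close>

lemma counts_surj:
  assumes "sorted_wrt (\<ge>) as" "sorted_wrt (\<ge>) bs" "burning_lists as bs"
    and "\<And>a. a \<in> set as \<Longrightarrow> a \<le> d + length bs" "\<And>b. b \<in> set bs \<Longrightarrow> b \<le> d"
    and "length as \<le> d"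
  shows "\<exists>w. u_counts w = as \<and> h_counts w = bs \<and> count_list w D = d \<and> nonneg_suffixes w"
  using assms
proof (induction "length as + length bs + d" arbitrary: as bs d)
  case 0
  then show ?case by (intro exI[of _ "[]"]) (auto simp: nonneg_suffixes_def)
next
  case (Suc n)
  show ?case
  proof (cases "as \<noteq> [] \<and> hd as = d + length bs")
    case True
    then obtain as' where as: "as = (d + length bs) # as'" by (cases as) auto
    have "\<exists>w. u_counts w = as' \<and> h_counts w = bs \<and> count_list w D = d \<and> nonneg_suffixes w"
      using Suc.prems Suc.hyps(2) unfolding as
      by (intro Suc.hyps(1)) (auto simp: burning_lists_Cons1)
    then obtain w where w: "u_counts w = as'" "h_counts w = bs" "count_list w D = d"
      "nonneg_suffixes w" by blast
    then show ?thesis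
      using as Suc.prems(6) length_u_counts[of w] length_h_counts[of w]
      by (intro exI[of _ "U # w"]) (auto simp: nonneg_suffixes_Cons)
  next
    case notU: False
    show ?thesis
    proof (cases "bs \<noteq> [] \<and> hd bs = d")
      case True
      then obtain bs' where bs: "bs = d # bs'" by (cases bs) auto
      have "a \<le> d + length bs'" if "a \<in> set as" for a
        using that Suc.prems(1,4) notU by (cases as) (fastforce simp: bs)+
      then have "\<exists>w. u_counts w = as \<and> h_counts w = bs' \<and> count_list w D = d \<and> nonneg_suffixes w"
        using Suc.prems Suc.hyps(2) unfolding bs
        by (intro Suc.hyps(1)) (auto simp: burning_lists_Cons2)
      then obtain w where w: "u_counts w = as" "h_counts w = bs'" "count_list w D = d"
        "nonneg_suffixes w" by blast
      then show ?thesis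
        using bs Suc.prems(6) length_u_counts[of w] length_h_counts[of w]
        by (intro exI[of _ "H # w"]) (auto simp: nonneg_suffixes_Cons)
    next
      case notH: False
      have A: "a < d + length bs" if "a \<in> set as" for a
        using that Suc.prems(1,4) notU by (cases as) fastforce+
      have B: "b < d" if "b \<in> set bs" for b
        using that Suc.prems(2,5) notH by (cases bs) fastforce+
      have "as = [] \<and> bs = [] \<or> (as \<noteq> [] \<and> length as + length bs \<le> as ! 0) \<or>
          (bs \<noteq> [] \<and> length as \<le> bs ! 0)"
        using Suc.prems(3)[unfolded burning_lists_def, rule_format, of 0 0] by auto
      then have less: "length as < d"
      proof (elim disjE conjE)
        assume "as = []" "bs = []" then show ?thesis using Suc.hyps(2) by simp
      next
        assume "as \<noteq> []" "length as + length bs \<le> as ! 0"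
        then show ?thesis using A[of "as ! 0"] by simp
      next
        assume "bs \<noteq> []" "length as \<le> bs ! 0"
        then show ?thesis using B[of "bs ! 0"] by simp
      qed
      then obtain d' where d: "d = Suc d'" by (cases d) auto
      have "\<exists>w. u_counts w = as \<and> h_counts w = bs \<and> count_list w D = d' \<and> nonneg_suffixes w"
        using Suc.prems Suc.hyps(2) less A B unfolding d
        by (intro Suc.hyps(1)) (auto simp: less_Suc_eq_le)
      then obtain w where w: "u_counts w = as" "h_counts w = bs" "count_list w D = d'"
        "nonneg_suffixes w" by blast
      then show ?thesis
        using d less length_u_counts[of w]
        by (intro exI[of _ "D # w"]) (auto simp: nonneg_suffixes_Cons)
    qed
  qed
qed

text \<open>
  Prefixes are turned into suffixes, since the counts of a configuration depend on what follows
  a letter.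
\<close>

lemma Motzkin_iff:
  "w \<in> Motzkin p q \<longleftrightarrow>
     nonneg_suffixes w \<and> count_list w U = p \<and> count_list w D = p \<and> count_list w H = q"
proof -
  have *: "count_list (take k w) x + count_list (drop k w) x = count_list w x" for k x
    by (metis append_take_drop_id count_list_append)
  have "count_list w U = count_list w D \<Longrightarrow>
     (count_list (take k w) D \<le> count_list (take k w) U) =
     (count_list (drop k w) U \<le> count_list (drop k w) D)" for k
    using *[of k U] *[of k D] by linarith
  then show ?thesis unfolding Motzkin_def nonneg_suffixes_def by auto
qed

section \<open>Weakly decreasing recurrent configurations of the split graph\<close>

definition clique_list :: "nat \<Rightarrow> vertex config \<Rightarrow> nat list" where
  "clique_list m c = map (\<lambda>i. c (Clique i) + 1) [1..<m]"

definition indep_list :: "nat \<Rightarrow> vertex config \<Rightarrow> nat list" where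
  "indep_list n c = map (\<lambda>j. c (Indep j)) [1..<Suc n]"

lemma length_clique_list [simp]: "length (clique_list m c) = m - 1"
  by (simp add: clique_list_def)

lemma length_indep_list [simp]: "length (indep_list n c) = n"
  by (simp add: indep_list_def)

lemma clique_list_nth: "i < m - 1 \<Longrightarrow> clique_list m c ! i = c (Clique (Suc i)) + 1"
  by (simp add: clique_list_def)

lemma indep_list_nth: "j < n \<Longrightarrow> indep_list n c ! j = c (Indep (Suc j))"
  by (simp add: indep_list_def del: upt_Suc)

lemma split_edges_iff:
  "{Clique i, Clique j} \<in> split_edges m n \<longleftrightarrow> i \<in> {1..m} \<and> j \<in> {1..m} \<and> i \<noteq> j"
  "{Clique i, Indep k} \<in> split_edges m n \<longleftrightarrow> i \<in> {1..m} \<and> k \<in> {1..n}"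
  "{Indep k, Clique i} \<in> split_edges m n \<longleftrightarrow> i \<in> {1..m} \<and> k \<in> {1..n}"
  "{Indep k, Indep l} \<notin> split_edges m n"
  by (auto simp: split_edges_def doubleton_eq_iff)

lemma neighbours_split:
  "neighbours (split_edges m n) (Clique i) =
     (if i \<in> {1..m} then Clique ` ({1..m} - {i}) \<union> Indep ` {1..n} else {})"
  "neighbours (split_edges m n) (Indep j) = (if j \<in> {1..n} then Clique ` {1..m} else {})"
proof -
  have *: "A = B" if "\<And>k. Clique k \<in> A \<longleftrightarrow> Clique k \<in> B" "\<And>k. Indep k \<in> A \<longleftrightarrow> Indep k \<in> B" for A B
    using that by (metis subsetI subset_antisym vertex.exhaust)
  show "neighbours (split_edges m n) (Clique i) =
     (if i \<in> {1..m} then Clique ` ({1..m} - {i}) \<union> Indep ` {1..n} else {})"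
    by (rule *) (auto simp: neighbours_def split_edges_iff)
  show "neighbours (split_edges m n) (Indep j) = (if j \<in> {1..n} then Clique ` {1..m} else {})"
    by (rule *) (auto simp: neighbours_def split_edges_iff)
qed

lemma neighbours_split_loopless: "v \<notin> neighbours (split_edges m n) v"
  by (cases v) (auto simp: neighbours_split)

lemma neighbours_split_subset: "neighbours (split_edges m n) v \<subseteq> split_verts m n"
  by (cases v) (auto simp: neighbours_split split_verts_def)

lemma finite_split_verts: "finite (split_verts m n)"
  by (simp add: split_verts_def)

lemma card_Clique_Indep:
  "finite I \<Longrightarrow> finite J \<Longrightarrow> card (Clique ` I \<union> Indep ` J) = card I + card J"
  by (subst card_Un_disjoint) (auto simp: card_image inj_on_def)

lemma deg_split:
  "i \<in> {1..m} \<Longrightarrow> deg (split_edges m n) (Clique i) = m - 1 + n"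
  "j \<in> {1..n} \<Longrightarrow> deg (split_edges m n) (Indep j) = m"
  by (auto simp: deg_def neighbours_split card_Clique_Indep card_image inj_on_def)

lemma neighbours_split_Int:
  assumes "A \<subseteq> split_verts m n"
  shows "i \<in> {1..m} \<Longrightarrow> neighbours (split_edges m n) (Clique i) \<inter> A =
           Clique ` (Clique -` A - {i}) \<union> Indep ` (Indep -` A)"
    and "j \<in> {1..n} \<Longrightarrow> neighbours (split_edges m n) (Indep j) \<inter> A = Clique ` (Clique -` A)"
  using assms by (auto simp: neighbours_split split_verts_def)

lemma card_neighbours_split_Int:
  assumes "A \<subseteq> split_verts m n"
  shows "i \<in> {1..m} \<Longrightarrow> card (neighbours (split_edges m n) (Clique i) \<inter> A) =
           card (Clique -` A - {i}) + card (Indep -` A)"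
    and "j \<in> {1..n} \<Longrightarrow> card (neighbours (split_edges m n) (Indep j) \<inter> A) = card (Clique -` A)"
proof -
  have "finite A" using assms finite_split_verts finite_subset by blast
  then have "finite (Clique -` A)" "finite (Indep -` A)"
    by (auto intro!: finite_vimageI simp: inj_on_def)
  then show "i \<in> {1..m} \<Longrightarrow> card (neighbours (split_edges m n) (Clique i) \<inter> A) =
           card (Clique -` A - {i}) + card (Indep -` A)"
    and "j \<in> {1..n} \<Longrightarrow> card (neighbours (split_edges m n) (Indep j) \<inter> A) = card (Clique -` A)"
    by (simp_all only: neighbours_split_Int[OF assms] card_Clique_Indep finite_Diff)
      (rule card_image, simp add: inj_on_def)
qed

text \<open>
  Replacing an arbitrary set \<open>A\<close> by the final segments that begin at the least indices occurring
  in it can only increase the number of neighbours inside the set, and keeps its largest entries.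
  So if the final segments are not forbidden, neither is \<open>A\<close>.
\<close>

lemma unforbidden_split_iff:
  assumes dec: "weakly_decreasing m n c"
  shows "unforbidden (split_verts m n) (split_edges m n) (Clique m) c \<longleftrightarrow>
           burning_lists (clique_list m c) (indep_list n c)"
    (is "?unf \<longleftrightarrow> ?burn")
proof
  assume unf: ?unf
  show ?burn
    unfolding burning_lists_def length_clique_list length_indep_list
  proof (intro allI impI)
    fix i j assume ij: "i \<le> m - 1" "j \<le> n"
    define A where "A = Clique ` {Suc i..<m} \<union> Indep ` {Suc j..n}"
    have pre: "Clique -` A = {Suc i..<m}" "Indep -` A = {Suc j..n}"
      by (auto simp: A_def)
    have A: "A \<subseteq> split_verts m n - {Clique m}" "A \<subseteq> split_verts m n"
      by (auto simp: A_def split_verts_def)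
    show "i = m - 1 \<and> j = n \<or>
        i < m - 1 \<and> m - 1 - i + (n - j) \<le> clique_list m c ! i \<or>
        j < n \<and> m - 1 - i \<le> indep_list n c ! j"
    proof (cases "A = {}")
      case True
      then show ?thesis using ij by (auto simp: A_def)
    next
      case False
      then obtain v where v: "v \<in> A" "card (neighbours (split_edges m n) v \<inter> A) \<le> c v"
        using unf A(1) unfolding unforbidden_def by blast
      show ?thesis
      proof (cases v)
        case (Clique k)
        then have k: "Suc i \<le> k" "k < m" using v(1) by (auto simp: A_def)
        then have "c (Clique k) \<le> c (Clique (Suc i))"
          using dec unfolding weakly_decreasing_def by auto
        moreover have "m - 1 - i - 1 + (n - j) \<le> c (Clique k)"
          using v(2) k unfolding Clique
          by (simp add: card_neighbours_split_Int[OF A(2)] pre)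
        ultimately show ?thesis using k by (auto simp: clique_list_nth)
      next
        case (Indep k)
        then have k: "Suc j \<le> k" "k \<le> n" using v(1) by (auto simp: A_def)
        then have "c (Indep k) \<le> c (Indep (Suc j))"
          using dec unfolding weakly_decreasing_def by auto
        moreover have "m - 1 - i \<le> c (Indep k)"
          using v(2) k unfolding Indep
          by (simp add: card_neighbours_split_Int[OF A(2)] pre)
        ultimately show ?thesis using k by (auto simp: indep_list_nth)
      qed
    qed
  qed
next
  assume burn: ?burn
  show ?unf
    unfolding unforbidden_def
  proof (intro allI impI, elim conjE)
    fix A assume A: "A \<subseteq> split_verts m n - {Clique m}" "A \<noteq> {}"
    then have A': "A \<subseteq> split_verts m n" by blast
    define I J where "I = Clique -` A" and "J = Indep -` A"
    have I: "I \<subseteq> {1..<m}" and J: "J \<subseteq> {1..n}"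
      using A(1) by (auto simp: I_def J_def split_verts_def)
    then have fin: "finite I" "finite J" by (auto intro: finite_subset)
    \<comment> \<open>an empty part of \<open>A\<close> is the empty final segment\<close>
    define i where "i = (if I = {} then m - 1 else Min I - 1)"
    define j where "j = (if J = {} then n else Min J - 1)"
    have Isub: "I \<subseteq> {Suc i..<m}"
    proof
      fix x assume "x \<in> I"
      then have "Min I \<le> x" "x \<in> {1..<m}" using fin I by auto
      then show "x \<in> {Suc i..<m}" using \<open>x \<in> I\<close> by (auto simp: i_def)
    qed
    have Jsub: "J \<subseteq> {Suc j..n}"
    proof
      fix x assume "x \<in> J"
      then have "Min J \<le> x" "x \<in> {1..n}" using fin J by auto
      then show "x \<in> {Suc j..n}" using \<open>x \<in> J\<close> by (auto simp: j_def)
    qed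
    have cardI: "card I \<le> m - 1 - i" and cardJ: "card J \<le> n - j"
      using card_mono[OF _ Isub] card_mono[OF _ Jsub] by auto
    have MinI: "Min I \<in> I" "Suc i = Min I" if "I \<noteq> {}"
    proof -
      show "Min I \<in> I" using fin that by simp
      then show "Suc i = Min I" using I that by (auto simp: i_def)
    qed
    have MinJ: "Min J \<in> J" "Suc j = Min J" if "J \<noteq> {}"
    proof -
      show "Min J \<in> J" using fin that by simp
      then show "Suc j = Min J" using J that by (auto simp: j_def)
    qed
    have "I \<noteq> {} \<or> J \<noteq> {}"
    proof -
      obtain v where "v \<in> A" using A(2) by blast
      then show ?thesis by (cases v) (auto simp: I_def J_def)
    qed
    then have notfull: "\<not> (i = m - 1 \<and> j = n)"
      using MinI MinJ Isub Jsub by fastforce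
    have ij: "i \<le> m - 1" "j \<le> n"
      using MinI MinJ I J by (fastforce simp: i_def j_def)+
    from burn[unfolded burning_lists_def, rule_format, of i j] ij notfull
    consider (clique) "i < m - 1" "m - 1 - i + (n - j) \<le> clique_list m c ! i"
      | (indep) "j < n" "m - 1 - i \<le> indep_list n c ! j"
      by auto
    then show "\<exists>v\<in>A. card (neighbours (split_edges m n) v \<inter> A) \<le> c v"
    proof cases
      case clique
      then have ne: "I \<noteq> {}" by (auto simp: i_def)
      then have mem: "Suc i \<in> I" using MinI by simp
      moreover have "card (I - {Suc i}) + card J \<le> c (Clique (Suc i))"
        using clique mem fin cardI cardJ by (simp add: clique_list_nth)
      ultimately show ?thesis
        using I by (intro bexI[of _ "Clique (Suc i)"])
          (auto simp: card_neighbours_split_Int[OF A'] I_def J_def)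
    next
      case indep
      then have ne: "J \<noteq> {}" by (auto simp: j_def)
      then have mem: "Suc j \<in> J" using MinJ by simp
      moreover have "card I \<le> c (Indep (Suc j))"
        using indep cardI by (simp add: indep_list_nth)
      ultimately show ?thesis
        using J by (intro bexI[of _ "Indep (Suc j)"])
          (auto simp: card_neighbours_split_Int[OF A'] I_def J_def)
    qed
  qed
qed

lemma weakly_decreasing_iff_sorted:
  "weakly_decreasing m n c \<longleftrightarrow>
     sorted_wrt (\<ge>) (clique_list m c) \<and> sorted_wrt (\<ge>) (indep_list n c)"
proof -
  have *: "(\<forall>i j. 1 \<le> i \<and> i \<le> j \<and> j \<le> l \<longrightarrow> f j \<le> f i) \<longleftrightarrow>
      (\<forall>i j. i < j \<longrightarrow> j < l \<longrightarrow> f (Suc j) \<le> f (Suc i))" (is "?L \<longleftrightarrow> ?R")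
    for f :: "nat \<Rightarrow> nat" and l
  proof
    assume R: ?R
    show ?L
    proof (intro allI impI)
      fix i j assume ij: "1 \<le> i \<and> i \<le> j \<and> j \<le> l"
      show "f j \<le> f i"
        using R[rule_format, of "i - 1" "j - 1"] ij by (cases "i = j") auto
    qed
  qed auto
  show ?thesis
    unfolding weakly_decreasing_def sorted_wrt_iff_nth_less
      *[of "m - 1" "\<lambda>i. c (Clique i)"] *[of n "\<lambda>i. c (Indep i)"]
    by (simp add: clique_list_nth indep_list_nth)
qed

lemma stable_split_iff:
  assumes "m \<ge> 1"
  shows "stable (split_verts m n) (split_edges m n) (Clique m) c \<longleftrightarrow>
    (\<forall>a\<in>set (clique_list m c). a \<le> m - 1 + n) \<and> (\<forall>b\<in>set (indep_list n c). b \<le> m - 1)"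
proof -
  have verts: "split_verts m n - {Clique m} = Clique ` {1..<m} \<union> Indep ` {1..n}"
    by (auto simp: split_verts_def)
  have "c (Clique i) < deg (split_edges m n) (Clique i) \<longleftrightarrow> c (Clique i) + 1 \<le> m - 1 + n"
    if "i \<in> {1..<m}" for i
    using that by (auto simp: deg_split)
  moreover have "c (Indep j) < deg (split_edges m n) (Indep j) \<longleftrightarrow> c (Indep j) \<le> m - 1"
    if "j \<in> {1..n}" for j
    using that assms by (auto simp: deg_split)
  moreover have "set [1..<Suc n] = {1..n}" by auto
  ultimately show ?thesis
    unfolding stable_def verts clique_list_def indep_list_def set_map
    by (simp add: ball_Un del: upt_Suc)
qed

lemma decreasing_recurrent_iff:
  assumes "m \<ge> 1"
  shows "c \<in> decreasing_recurrent m n \<longleftrightarrow>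
    c \<in> configs (split_verts m n) (Clique m) \<and>
    sorted_wrt (\<ge>) (clique_list m c) \<and> sorted_wrt (\<ge>) (indep_list n c) \<and>
    burning_lists (clique_list m c) (indep_list n c) \<and>
    (\<forall>a\<in>set (clique_list m c). a \<le> m - 1 + n) \<and> (\<forall>b\<in>set (indep_list n c). b \<le> m - 1)"
proof -
  let ?V = "split_verts m n" and ?E = "split_edges m n" and ?s = "Clique m"
  have "?s \<in> neighbours ?E v" if "v \<in> ?V - {?s}" for v
    using that assms by (cases v) (auto simp: neighbours_split split_verts_def)
  note sink = this
  have fin: "finite (neighbours ?E v)" for v
    using neighbours_split_subset finite_split_verts by (rule finite_subset)
  have "recurrent ?V ?E ?s c \<longleftrightarrow>
      c \<in> configs ?V ?s \<and> stable ?V ?E ?s c \<and> unforbidden ?V ?E ?s c"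
  proof
    assume "recurrent ?V ?E ?s c"
    then show "c \<in> configs ?V ?s \<and> stable ?V ?E ?s c \<and> unforbidden ?V ?E ?s c"
      using recurrent_imp_unforbidden[OF _ neighbours_split_loopless fin]
      by (simp add: recurrent_def)
  next
    assume "c \<in> configs ?V ?s \<and> stable ?V ?E ?s c \<and> unforbidden ?V ?E ?s c"
    then show "recurrent ?V ?E ?s c"
      by (intro unforbidden_imp_recurrent neighbours_split_loopless finite_split_verts
          neighbours_split_subset sink) auto
  qed
  then show ?thesis
    using assms unfolding decreasing_recurrent_def
    by (auto simp: unforbidden_split_iff weakly_decreasing_iff_sorted stable_split_iff)
qed

lemma config_eqI:
  assumes "c \<in> configs (split_verts m n) (Clique m)" "c' \<in> configs (split_verts m n) (Clique m)"
    and "clique_list m c = clique_list m c'" "indep_list n c = indep_list n c'"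
  shows "c = c'"
proof
  fix v
  have C: "c (Clique i) = c' (Clique i)" if "i \<in> {1..<m}" for i
    using that assms(3) unfolding clique_list_def by auto
  have J: "c (Indep j) = c' (Indep j)" if "j \<in> {1..n}" for j
    using that assms(4) unfolding indep_list_def by (auto simp del: upt_Suc)
  show "c v = c' v"
  proof (cases "v \<in> split_verts m n - {Clique m}")
    case True
    then consider i where "v = Clique i" "i \<in> {1..<m}" | j where "v = Indep j" "j \<in> {1..n}"
      unfolding split_verts_def by fastforce
    then show ?thesis by cases (simp_all add: C J)
  next
    case False
    then show ?thesis using assms(1,2) by (auto simp: configs_def)
  qed
qed

lemma u_counts_pos: "nonneg_suffixes w \<Longrightarrow> x \<in> set (u_counts w) \<Longrightarrow> 1 \<le> x"
  by (induction w) (auto simp: nonneg_suffixes_Cons split: if_splits)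

lemma motzkin_config_lists:
  assumes "w \<in> Motzkin (m - 1) n"
  shows "clique_list m (motzkin_config m n w) = u_counts w"
    and "indep_list n (motzkin_config m n w) = h_counts w"
proof -
  have w: "nonneg_suffixes w" "count_list w U = m - 1" "count_list w H = n"
    using assms by (auto simp: Motzkin_iff)
  show "clique_list m (motzkin_config m n w) = u_counts w"
  proof (rule nth_equalityI)
    fix i assume "i < length (clique_list m (motzkin_config m n w))"
    then have i: "i < m - 1" "i < count_list w U" using w by auto
    have "1 \<le> u_counts w ! i"
      using i by (intro u_counts_pos[OF w(1)]) (simp add: length_u_counts)
    then show "clique_list m (motzkin_config m n w) ! i = u_counts w ! i"
      using i by (simp add: clique_list_nth motzkin_config_def u_counts_nth del: after.simps)
  qed (simp add: length_u_counts w)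
  show "indep_list n (motzkin_config m n w) = h_counts w"
  proof (rule nth_equalityI)
    fix j assume "j < length (indep_list n (motzkin_config m n w))"
    then have j: "j < n" "j < count_list w H" using w by auto
    then show "indep_list n (motzkin_config m n w) ! j = h_counts w ! j"
      by (simp add: indep_list_nth motzkin_config_def h_counts_nth del: after.simps)
  qed (simp add: length_h_counts w)
qed

lemma motzkin_config_in_configs: "motzkin_config m n w \<in> configs (split_verts m n) (Clique m)"
  by (auto simp: configs_def motzkin_config_def split_verts_def split: vertex.splits)

lemma bij_betw_motzkin_config:
  assumes "m \<ge> 1"
  shows "bij_betw (motzkin_config m n) (Motzkin (m - 1) n) (decreasing_recurrent m n)"
  unfolding bij_betw_def
proof (intro conjI inj_onI equalityI subsetI)
  fix w w' assume "w \<in> Motzkin (m - 1) n" "w' \<in> Motzkin (m - 1) n"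
    "motzkin_config m n w = motzkin_config m n w'"
  then show "w = w'"
    using motzkin_config_lists[of w m n] motzkin_config_lists[of w' m n]
    by (intro counts_inj) (auto simp: Motzkin_iff)
next
  fix c assume "c \<in> motzkin_config m n ` Motzkin (m - 1) n"
  then obtain w where w: "w \<in> Motzkin (m - 1) n" "c = motzkin_config m n w" by blast
  then show "c \<in> decreasing_recurrent m n"
    using assms burning_lists_counts[of w] u_counts_le[of _ w] h_counts_le[of _ w]
    by (auto simp: decreasing_recurrent_iff motzkin_config_lists motzkin_config_in_configs
        sorted_u_counts sorted_h_counts Motzkin_iff)
next
  fix c assume c: "c \<in> decreasing_recurrent m n"
  have "\<exists>w. u_counts w = clique_list m c \<and> h_counts w = indep_list n c \<and>
      count_list w D = m - 1 \<and> nonneg_suffixes w"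
    using c assms by (intro counts_surj) (auto simp: decreasing_recurrent_iff)
  then obtain w where w: "u_counts w = clique_list m c" "h_counts w = indep_list n c"
      "count_list w D = m - 1" "nonneg_suffixes w" by blast
  then have M: "w \<in> Motzkin (m - 1) n"
    using length_u_counts[of w] length_h_counts[of w] by (simp add: Motzkin_iff)
  have "motzkin_config m n w = c"
    using c assms w motzkin_config_lists[OF M] motzkin_config_in_configs[of m n w]
    by (intro config_eqI[of _ m n]) (auto simp: decreasing_recurrent_iff)
  with M show "c \<in> motzkin_config m n ` Motzkin (m - 1) n" by blast
qed

section \<open>The cycle lemma\<close>

definition height :: "letter list \<Rightarrow> int" where
  "height w = int (count_list w U) - int (count_list w D)"

definition pos_prefixes :: "letter list \<Rightarrow> bool" where
  "pos_prefixes w \<longleftrightarrow> (\<forall>k. 0 < k \<and> k \<le> length w \<longrightarrow> 0 < height (take k w))"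

lemma height_Nil [simp]: "height [] = 0"
  by (simp add: height_def)

lemma height_append [simp]: "height (u @ v) = height u + height v"
  by (simp add: height_def)

text \<open>
  The rotation starts at the last position where the prefix heights attain their minimum: every
  later prefix is strictly higher, and wrapping around adds the total height 1.
\<close>

lemma exists_pos_rotation:
  assumes "height w = 1"
  shows "\<exists>k. pos_prefixes (rotate k w)"
proof -
  define S where "S i = height (take i w)" for i
  have "w \<noteq> []" using assms by (auto simp: height_def)
  then have ne: "{..<length w} \<noteq> {}" by auto
  define M where "M = {k \<in> {..<length w}. \<forall>j<length w. S k \<le> S j}"
  have "\<exists>k\<in>{..<length w}. \<forall>j\<in>{..<length w}. S k \<le> S j"
    using ex_min_if_finite[of "S ` {..<length w}"] ne by (fastforce simp: not_less)
  then have M: "finite M" "M \<noteq> {}" by (auto simp: M_def)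
  define k where "k = Max M"
  have "k \<in> M" using M by (simp add: k_def)
  then have k: "k < length w" "\<And>j. j < length w \<Longrightarrow> S k \<le> S j" by (auto simp: M_def)
  have last: "S k < S j" if "k < j" "j < length w" for j
  proof (rule ccontr)
    assume "\<not> S k < S j"
    then have "j \<in> M" using k that by (force simp: M_def)
    then show False using Max_ge[OF M(1), of j] that by (simp add: k_def)
  qed
  have "S 0 = 0" "S (length w) = 1" using assms by (simp_all add: S_def)
  have "S k \<le> 0" using k(2)[of 0] k(1) \<open>S 0 = 0\<close> by force
  have drop: "height (take j (drop k w)) = S (k + j) - S k" for j
    by (simp add: S_def take_add)
  have "pos_prefixes (drop k w @ take k w)"
    unfolding pos_prefixes_def
  proof (intro allI impI)
    fix j assume j: "0 < j \<and> j \<le> length (drop k w @ take k w)"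
    show "0 < height (take j (drop k w @ take k w))"
    proof (cases "j \<le> length w - k")
      case True
      then have "height (take j (drop k w @ take k w)) = S (k + j) - S k"
        by (simp add: drop)
      moreover have "S k < S (k + j)"
      proof (cases "k + j < length w")
        case False
        then have "k + j = length w" using True k by simp
        then show ?thesis using \<open>S (length w) = 1\<close> \<open>S k \<le> 0\<close> by simp
      qed (use j last in simp)
      ultimately show ?thesis by simp
    next
      case False
      have "height (drop k w) = 1 - S k"
        using drop[of "length w - k"] k(1) \<open>S (length w) = 1\<close> by simp
      moreover have le: "j - (length w - k) \<le> k" using j k(1) by auto
      then have "take (j - (length w - k)) (take k w) = take (j - (length w - k)) w"
        by (simp add: min_absorb1)
      ultimately have "height (take j (drop k w @ take k w)) = 1 - S k + S (j - (length w - k))"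
        using False by (simp add: S_def)
      moreover have "S k \<le> S (j - (length w - k))" using le k by (meson le_less_trans)
      ultimately show ?thesis by linarith
    qed
  qed
  then show ?thesis using k(1) by (intro exI[of _ k]) (simp add: rotate_drop_take)
qed

text \<open>
  Two distinct positive rotations would cut the circle into two arcs of height at least 1, while
  the total height is 1.
\<close>

lemma pos_rotation_unique:
  assumes "pos_prefixes w" "pos_prefixes (rotate k w)" "height w = 1"
  shows "rotate k w = w"
proof (rule ccontr)
  assume ne: "rotate k w \<noteq> w"
  define l where "l = k mod length w"
  have rot: "rotate k w = drop l w @ take l w" by (simp add: l_def rotate_drop_take)
  have "w \<noteq> []" using ne by auto
  then have l: "l < length w" by (simp add: l_def)
  moreover have "l \<noteq> 0" using ne rot by (intro notI) simp
  ultimately have l: "0 < l" "l < length w" by auto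
  have "0 < height (take l w)" using assms(1) l by (simp add: pos_prefixes_def)
  moreover have "0 < height (drop l w)"
    using assms(2)[unfolded rot pos_prefixes_def, rule_format, of "length w - l"] l by simp
  moreover have "height (take l w) + height (drop l w) = height w"
    by (metis append_take_drop_id height_append)
  ultimately show False using assms(3) by simp
qed

lemma pos_prefixes_Cons_U:
  "pos_prefixes (U # w) \<longleftrightarrow> (\<forall>k. count_list (take k w) D \<le> count_list (take k w) U)"
proof -
  have "pos_prefixes (U # w) \<longleftrightarrow> (\<forall>k\<le>length w. 0 < height (take (Suc k) (U # w)))"
    unfolding pos_prefixes_def
    by (metis Suc_le_mono length_Cons not0_implies_Suc zero_less_Suc less_irrefl)
  also have "\<dots> \<longleftrightarrow> (\<forall>k\<le>length w. count_list (take k w) D \<le> count_list (take k w) U)"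
    by (auto simp: height_def)
  also have "\<dots> \<longleftrightarrow> (\<forall>k. count_list (take k w) D \<le> count_list (take k w) U)"
    by (metis nle_le take_all)
  finally show ?thesis .
qed

text \<open>
  A positive first prefix is the letter \<open>U\<close>; deleting it lowers all remaining prefix heights by
  one, so that positive becomes nonnegative.
\<close>

lemma Cons_U_Motzkin_iff:
  assumes "m \<ge> 1"
  shows "w \<in> Cons U ` Motzkin (m - 1) n \<longleftrightarrow>
    pos_prefixes w \<and> count_list w U = m \<and> count_list w D = m - 1 \<and> count_list w H = n"
proof (cases "\<exists>v. w = U # v")
  case True
  then show ?thesis
    using assms by (auto simp: Motzkin_def pos_prefixes_Cons_U)
next
  case False
  have "\<not> (pos_prefixes w \<and> count_list w U = m)"
  proof
    assume *: "pos_prefixes w \<and> count_list w U = m"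
    then have "w \<noteq> []" using assms by auto
    then obtain x v where "w = x # v" by (cases w) auto
    moreover have "0 < height (take 1 w)"
      using * \<open>w \<noteq> []\<close> unfolding pos_prefixes_def by (simp add: Suc_le_eq)
    ultimately show False using False by (cases x) (auto simp: height_def)
  qed
  then show ?thesis using False by auto
qed

lemma count_list_rotate [simp]: "count_list (rotate k w) x = count_list w x"
  by (metis add.commute append_take_drop_id count_list_append rotate_drop_take)

lemma necklace_rotate: "necklace (rotate k w) = necklace w"
proof (cases "w = []")
  case False
  have "rotate j w \<in> necklace (rotate k w)" for j
  proof -
    have "rotate j w = rotate (j + k * length w) w"
      by (metis mod_mult_self1 rotate_conv_mod)
    also have "j + k * length w = (j + k * length w - k) + k"
      using False by (cases "length w") auto
    finally show ?thesis unfolding necklace_def rotate_rotate by blast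
  qed
  then show ?thesis by (auto simp: necklace_def rotate_rotate)
qed simp

lemma necklace_eqD: "necklace w = necklace w' \<Longrightarrow> \<exists>k. w' = rotate k w"
proof -
  assume "necklace w = necklace w'"
  moreover have "rotate 0 w' \<in> necklace w'" unfolding necklace_def by blast
  ultimately show ?thesis by (auto simp: necklace_def)
qed

lemma bij_betw_Motzkin_Necklaces1:
  assumes "m \<ge> 1"
  shows "bij_betw (\<lambda>\<alpha>. necklace (U # \<alpha>)) (Motzkin (m - 1) n) (Necklaces1 m (m - 1) n)"
  unfolding bij_betw_def
proof (intro conjI inj_onI equalityI subsetI)
  fix \<alpha> \<beta> assume M: "\<alpha> \<in> Motzkin (m - 1) n" "\<beta> \<in> Motzkin (m - 1) n"
    and "necklace (U # \<alpha>) = necklace (U # \<beta>)"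
  then obtain k where k: "U # \<beta> = rotate k (U # \<alpha>)" using necklace_eqD by blast
  have "pos_prefixes (U # \<alpha>)" "pos_prefixes (U # \<beta>)" "height (U # \<alpha>) = 1"
    using M by (auto simp: Motzkin_def pos_prefixes_Cons_U height_def)
  then show "\<alpha> = \<beta>" using pos_rotation_unique[of "U # \<alpha>" k] k by simp
next
  fix N assume "N \<in> (\<lambda>\<alpha>. necklace (U # \<alpha>)) ` Motzkin (m - 1) n"
  then show "N \<in> Necklaces1 m (m - 1) n"
    using assms by (auto simp: Necklaces1_def Motzkin_def)
next
  fix N assume "N \<in> Necklaces1 m (m - 1) n"
  then obtain w where w: "N = necklace w" "count_list w U = m" "count_list w D = m - 1"
    "count_list w H = n" by (auto simp: Necklaces1_def)
  then have "height w = 1" using assms by (simp add: height_def of_nat_diff)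
  then obtain k where "pos_prefixes (rotate k w)" using exists_pos_rotation by blast
  then have "rotate k w \<in> Cons U ` Motzkin (m - 1) n"
    unfolding Cons_U_Motzkin_iff[OF assms] by (simp add: w)
  then obtain \<alpha> where "\<alpha> \<in> Motzkin (m - 1) n" "rotate k w = U # \<alpha>" by blast
  then show "N \<in> (\<lambda>\<alpha>. necklace (U # \<alpha>)) ` Motzkin (m - 1) n"
    using w(1) necklace_rotate[of k w] by auto
qed

section \<open>The correspondence\<close>

theorem mainTheorem7:
  fixes m n :: nat
  assumes "m \<ge> 1" and "n \<ge> 1"
  shows "(\<forall>c \<in> decreasing_recurrent m n.
            \<exists>!\<alpha>. \<alpha> \<in> Motzkin (m - 1) n \<and> motzkin_config m n \<alpha> = c) \<and>
         bij_betw
           (\<lambda>c. necklace (U # (THE \<alpha>. \<alpha> \<in> Motzkin (m - 1) n \<and> motzkin_config m n \<alpha> = c)))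
           (decreasing_recurrent m n)
           (Necklaces1 m (m - 1) n)"
proof
  note f = bij_betw_motzkin_config[OF assms(1), of n]
  show "\<forall>c \<in> decreasing_recurrent m n.
          \<exists>!\<alpha>. \<alpha> \<in> Motzkin (m - 1) n \<and> motzkin_config m n \<alpha> = c"
  proof
    fix c assume "c \<in> decreasing_recurrent m n"
    then have "c \<in> motzkin_config m n ` Motzkin (m - 1) n"
      unfolding bij_betw_imp_surj_on[OF f] .
    then obtain \<alpha> where "\<alpha> \<in> Motzkin (m - 1) n" "motzkin_config m n \<alpha> = c"
      by (elim imageE) simp
    then show "\<exists>!\<alpha>. \<alpha> \<in> Motzkin (m - 1) n \<and> motzkin_config m n \<alpha> = c"
      using inj_onD[OF bij_betw_imp_inj_on[OF f]] by (intro ex1I[of _ \<alpha>]) auto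
  qed
  show "bij_betw
           (\<lambda>c. necklace (U # (THE \<alpha>. \<alpha> \<in> Motzkin (m - 1) n \<and> motzkin_config m n \<alpha> = c)))
           (decreasing_recurrent m n)
           (Necklaces1 m (m - 1) n)"
    using bij_betw_trans[OF bij_betw_the_inv_into[OF f] bij_betw_Motzkin_Necklaces1[OF assms(1)]]
    unfolding comp_def the_inv_into_def .
qed

end
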